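(* For all positive integers $n$ and $q$ and every subset $B\subseteq[q,n+q-1]$, $$\sum_{\{\pi\in S_{n+q-1}\mid Des_q(\pi^{-1})=B\}} t^{inv_q(\pi)}=\sum_{\{\pi\in S_{n+q-1}\mid Des_q(\pi^{-1})=B\}} t^{rmaj_{q,n+q-1}(\pi)}.$$
   Context: $t$ is an indeterminate; $[a,b]$ denotes the set of integers $i$ with $a\le i\le b$. Let $m=n+q-1$ and $\pi\in S_m$. The $q$-inversion number: $inv_q(\pi)=\sum_{i=q+1}^m \min\{\,i-q,\ \#\{j<i\mid \pi(j)>\pi(i)\}\,\}$ (equal to $0$ if $m\le q$). $Del_q(\pi)=\{ i \mid q+1\le i\le m,\ \#\{j<i\mid \pi(j)<\pi(i)\}\le q-1\}$. The $q$-descent set $Des_q(\pi)$ is the set of $i$ with $q\le i\le m-1$ such that $\pi(i)>\pi(i+1)$ or $i+1\in Del_q(\pi)$ (or both). The $q$-reverse major index: $rmaj_{q,m}(\pi)=\sum_{i\in Des_q(\pi)}(m-i)$. *)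

theory Defs
  imports
    "HOL-Combinatorics.Permutations"
    "HOL-Computational_Algebra.Polynomial"
begin

text \<open>
  The symmetric group on \<open>m\<close> letters is \<open>{p. p permutes {1..m}}\<close>, a set of
  functions on \<open>nat\<close>.  As these fix \<open>0\<close>, the position \<open>0\<close> has to be excluded when
  positions \<open>j < i\<close> are counted; hence the ranges \<open>{1..<i}\<close>.
\<close>

definition inv_q :: "nat \<Rightarrow> nat \<Rightarrow> (nat \<Rightarrow> nat) \<Rightarrow> nat" where
  "inv_q q m p = (\<Sum>i\<in>{q+1..m}. min (i - q) (card {j \<in> {1..<i}. p j > p i}))"

definition Del_q :: "nat \<Rightarrow> nat \<Rightarrow> (nat \<Rightarrow> nat) \<Rightarrow> nat set" where
  "Del_q q m p = {i \<in> {q+1..m}. card {j \<in> {1..<i}. p j < p i} \<le> q - 1}"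

definition Des_q :: "nat \<Rightarrow> nat \<Rightarrow> (nat \<Rightarrow> nat) \<Rightarrow> nat set" where
  "Des_q q m p = {i \<in> {q..<m}. p i > p (i + 1) \<or> i + 1 \<in> Del_q q m p}"

definition rmaj_q :: "nat \<Rightarrow> nat \<Rightarrow> (nat \<Rightarrow> nat) \<Rightarrow> nat" where
  "rmaj_q q m p = (\<Sum>i\<in>Des_q q m p. m - i)"

end

theory Submission
  imports Defs "HOL-Library.FuncSet" "HOL-Combinatorics.Multiset_Permutations"
begin

text \<open>
  Put \<open>m = n + q - 1\<close>, let \<open>a\<^sub>i\<close> be the number of larger entries to the left of position \<open>i\<close> of a
  permutation, and truncate this inversion code to \<open>min (i - q) a\<^sub>i\<close>. Both \<open>inv_q\<close> and \<open>Des_q\<close>,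
  hence \<open>rmaj_q\<close>, are functions of the truncated code: \<open>inv_q\<close> is its sum and \<open>Des_q\<close> its set of
  ascents (\<open>inv_q_cut_code\<close>, \<open>Des_q_cut_code\<close>). The truncated code also determines the truncated
  code of the inverse permutation (\<open>cut_code_inv\<close>). Indeed, call a position an almost minimum if
  fewer than \<open>q\<close> smaller entries stand to the left of it. Knowing the truncated code is the same
  as knowing the points \<open>(i, p i)\<close> of the graph that are not almost minima, a condition that is
  symmetric under transposition. Therefore both sides of the identity are sums over the fibres of
  the truncated code, of terms that are constant on each fibre.

  A fibre has \<open>q! q\<^sup>d\<close> elements, where \<open>d\<close> is the number of elements of \<open>Del_q\<close>
  (\<open>card_cut_code_fibre\<close>), and it contains exactly one permutation that moves only the letters
  \<open>q, \<dots>, m\<close>. Writing the latter as a word on \<open>{q..m}\<close>, the statistics become ordinary ones: the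
  inversion number, the reverse major index, the set of \<open>k\<close> such that \<open>k + 1\<close> precedes \<open>k\<close>, and
  the number \<open>d + 1\<close> of left-to-right minima (\<open>inverse_descent_sum_words\<close>).

  It remains to have a bijection on words that turns the reverse major index into the inversion
  number and keeps the other two. Foata's second fundamental transformation, in a version that
  builds the word by prepending letters, does this: each step interchanges only letters smaller
  than the new letter \<open>x\<close> with letters larger than \<open>x\<close>, so neither the order of consecutive values
  nor the left-to-right minima change (\<open>inversions_foata\<close>, \<open>precedes_foata\<close>, \<open>left_minima_foata\<close>).
\<close>

section \<open>Foata's transformation for the reverse major index\<close>

fun inversions :: "'a::linorder list \<Rightarrow> nat" where
  "inversions [] = 0"
| "inversions (x # xs) = length (filter (\<lambda>y. y < x) xs) + inversions xs"

text \<open>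
  The reverse major index weighs a descent by the number of letters to the right of it, so it
  can be computed by prepending letters; this is why the whole transformation recurses from the
  right end of the word.
\<close>

fun rev_major :: "'a::linorder list \<Rightarrow> nat" where
  "rev_major (x # y # xs) = (if y < x then length (y # xs) else 0) + rev_major (y # xs)"
| "rev_major _ = 0"

fun left_minima :: "'a::linorder list \<Rightarrow> 'a set" where
  "left_minima [] = {}"
| "left_minima (x # xs) = insert x {y \<in> left_minima xs. y < x}"

fun precedes :: "'a list \<Rightarrow> 'a \<Rightarrow> 'a \<Rightarrow> bool" where
  "precedes [] a b = False"
| "precedes (x # xs) a b = ((x = a \<and> b \<in> set xs) \<or> precedes xs a b)"

text \<open>
  Cut the word into blocks, each consisting of a letter satisfying \<open>P\<close> and the following
  letters that do not, and move the head of every block to the end of its block. The letter \<open>c\<close>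
  is the head that is currently being moved.
\<close>

fun carry :: "('a \<Rightarrow> bool) \<Rightarrow> 'a \<Rightarrow> 'a list \<Rightarrow> 'a list" where
  "carry P c [] = [c]"
| "carry P c (y # ys) = (if P y then c # carry P y ys else y # carry P c ys)"

text \<open>
  The choice of the predicate makes the first letter of \<open>v\<close> head a block, so that the blocks
  exhaust the word.
\<close>

definition foata_step :: "'a::linorder \<Rightarrow> 'a list \<Rightarrow> 'a list" where
  "foata_step x v = (case v of [] \<Rightarrow> []
     | y # ys \<Rightarrow> carry (if y < x then (\<lambda>z. z < x) else (\<lambda>z. x < z)) y ys)"

fun foata :: "'a::linorder list \<Rightarrow> 'a list" where
  "foata [] = []"
| "foata (x # xs) = x # foata_step x (foata xs)"

lemma mset_carry: "mset (carry P c ys) = mset (c # ys)"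
  by (induction P c ys rule: carry.induct) auto

lemma mset_foata_step: "mset (foata_step x v) = mset v"
  by (cases v) (simp_all add: foata_step_def mset_carry)

lemma mset_foata: "mset (foata xs) = mset xs"
  by (induction xs) (simp_all add: mset_foata_step)

lemma set_foata: "set (foata xs) = set xs"
  using mset_foata mset_eq_setD by blast

lemma set_foata_step: "set (foata_step x v) = set v"
  using mset_foata_step mset_eq_setD by blast

lemma length_foata: "length (foata xs) = length xs"
  using mset_foata mset_eq_length by blast

lemma distinct_foata: "distinct (foata xs) = distinct xs"
  using mset_foata mset_eq_imp_distinct_iff by blast

lemma carry_inject:
  assumes "P c" "P d"
  shows "carry P c ys = carry P d zs \<longleftrightarrow> c = d \<and> ys = zs"
  using assms
proof (induction ys arbitrary: c d zs)
  case Nil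
  have "length (carry P d zs) = Suc (length zs)"
    by (metis mset_carry mset_eq_length length_Cons)
  then show ?case by (cases zs) auto
next
  case (Cons y ys)
  have "length (carry P c (y # ys)) = Suc (Suc (length ys))"
    by (metis mset_carry mset_eq_length length_Cons)
  then show ?case
    using Cons by (cases zs) (auto split: if_splits)
qed

text \<open>
  The last letter of the rearranged word reveals which of the two predicates was used; this makes
  one step of the transformation injective.
\<close>

lemma last_carry: "P c \<Longrightarrow> P (last (carry P c ys))"
proof (induction P c ys rule: carry.induct)
  case (2 P c y ys)
  have "carry P d ys \<noteq> []" for d
    by (metis mset_carry list.distinct(1) mset_zero_iff)
  with 2 show ?case by auto
qed auto

lemma foata_step_inject:
  assumes "x \<notin> set v" "x \<notin> set w" "foata_step x v = foata_step x w"
  shows "v = w"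
proof (cases v; cases w)
  fix y ys z zs assume vw: "v = y # ys" "w = z # zs"
  define P where "P y = (if y < x then (\<lambda>z. z < x) else (\<lambda>z. x < z))" for y
  have P: "P y y" "P z z" using assms vw by (auto simp: P_def)
  have eq: "carry (P y) y ys = carry (P z) z zs"
    using assms(3) vw by (simp add: foata_step_def P_def)
  have "P y (last (carry (P z) z zs))" "P z (last (carry (P z) z zs))"
    using last_carry[of "P y", OF P(1), of ys] last_carry[of "P z", OF P(2), of zs] eq by simp_all
  then have "P y = P z" by (auto simp: P_def split: if_splits)
  then show ?thesis
    using eq P carry_inject[of "P z" y z ys zs] vw by simp
next
  fix z zs assume "v = []" "w = z # zs"
  then show ?thesis using assms(3) mset_foata_step[of x v] mset_foata_step[of x w] by auto
next
  fix z zs assume "v = z # zs" "w = []"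
  then show ?thesis using assms(3) mset_foata_step[of x v] mset_foata_step[of x w] by auto
qed auto

lemma foata_inject:
  assumes "distinct xs" "distinct ys" "foata xs = foata ys"
  shows "xs = ys"
  using assms
proof (induction xs arbitrary: ys)
  case Nil
  then show ?case using length_foata[of ys] by simp
next
  case (Cons x xs)
  have "ys \<noteq> []" using Cons.prems(3) by force
  then obtain z zs where ys: "ys = z # zs" by (meson neq_Nil_conv)
  have step: "z = x" "foata_step x (foata xs) = foata_step x (foata zs)"
    using Cons.prems(3) by (auto simp: ys)
  have "x \<notin> set (foata xs)" "x \<notin> set (foata zs)"
    using Cons.prems ys step(1) by (simp_all add: set_foata)
  then have "foata xs = foata zs" using step(2) foata_step_inject by blast
  then have "xs = zs" using Cons.IH[of zs] Cons.prems ys by simp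
  then show ?case using ys step(1) by simp
qed

text \<open>
  Only pairs of one letter satisfying \<open>P\<close> and one letter violating it are interchanged.
\<close>

lemma filter_carry:
  assumes "P c"
  shows "filter P (carry P c ys) = c # filter P ys"
    and "filter (\<lambda>z. \<not> P z) (carry P c ys) = filter (\<lambda>z. \<not> P z) ys"
  using assms by (induction ys arbitrary: c) auto

lemma filter_foata_step:
  assumes "x \<notin> set v"
  shows "filter (\<lambda>z. z < x) (foata_step x v) = filter (\<lambda>z. z < x) v"
    and "filter (\<lambda>z. x < z) (foata_step x v) = filter (\<lambda>z. x < z) v"
proof -
  have 1: "filter (\<lambda>z. \<not> z < x) w = filter (\<lambda>z. x < z) w"
    and 2: "filter (\<lambda>z. \<not> x < z) w = filter (\<lambda>z. z < x) w" if "x \<notin> set w" for w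
    using that by (metis (mono_tags, lifting) filter_cong linorder_cases order_less_asym)+
  have x: "x \<notin> set (foata_step x v)" using assms by (simp add: set_foata_step)
  have "filter (\<lambda>z. z < x) (foata_step x v) = filter (\<lambda>z. z < x) v \<and>
    filter (\<lambda>z. x < z) (foata_step x v) = filter (\<lambda>z. x < z) v"
  proof (cases v)
    case Nil
    then show ?thesis by (simp add: foata_step_def)
  next
    case (Cons y ys)
    have ys: "x \<notin> set ys" "x \<noteq> y" using assms Cons by auto
    show ?thesis
    proof (cases "y < x")
      case True
      then have "foata_step x v = carry (\<lambda>z. z < x) y ys" by (simp add: Cons foata_step_def)
      moreover have "\<not> x < y" using True by simp
      ultimately show ?thesis
        using filter_carry[of "\<lambda>z. z < x" y ys] True x 1[of "foata_step x v"] 1[OF ys(1)]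
        by (simp add: Cons)
    next
      case False
      then have "x < y" using ys by simp
      moreover have "foata_step x v = carry (\<lambda>z. x < z) y ys"
        using False by (simp add: Cons foata_step_def)
      ultimately show ?thesis
        using filter_carry[of "\<lambda>z. x < z" y ys] False x 2[of "foata_step x v"] 2[OF ys(1)]
        by (simp add: Cons)
    qed
  qed
  then show "filter (\<lambda>z. z < x) (foata_step x v) = filter (\<lambda>z. z < x) v"
    "filter (\<lambda>z. x < z) (foata_step x v) = filter (\<lambda>z. x < z) v" by auto
qed

text \<open>
  Every letter that violates \<open>P\<close> is overtaken by exactly one letter that satisfies it, namely
  the head of its block; each such passage creates one inversion here, and destroys one in the
  following lemma.
\<close>

lemma inversions_carry_small:
  assumes "\<And>z w. z \<in> set (c # ys) \<Longrightarrow> w \<in> set (c # ys) \<Longrightarrow> P z \<Longrightarrow> \<not> P w \<Longrightarrow> z < w" "P c"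
  shows "inversions (carry P c ys) = inversions (c # ys) + length (filter (\<lambda>z. \<not> P z) ys)"
  using assms
proof (induction ys arbitrary: c)
  case (Cons y ys)
  have len: "length (filter Q (carry P d ys)) = length (filter Q (d # ys))" for Q d
    by (metis mset_carry mset_filter size_mset)
  show ?case
  proof (cases "P y")
    case True
    have "inversions (carry P y ys) = inversions (y # ys) + length (filter (\<lambda>z. \<not> P z) ys)"
      by (rule Cons.IH) (simp_all add: Cons.prems True)
    then show ?thesis using True len by simp
  next
    case False
    have "inversions (carry P c ys) = inversions (c # ys) + length (filter (\<lambda>z. \<not> P z) ys)"
      by (rule Cons.IH) (use Cons.prems in auto)
    moreover have "c < y" using Cons.prems(1)[of c y] Cons.prems(2) False by simp
    ultimately show ?thesis using False len by simp
  qed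
qed simp

lemma inversions_carry_large:
  assumes "\<And>z w. z \<in> set (c # ys) \<Longrightarrow> w \<in> set (c # ys) \<Longrightarrow> P z \<Longrightarrow> \<not> P w \<Longrightarrow> w < z" "P c"
  shows "inversions (carry P c ys) + length (filter (\<lambda>z. \<not> P z) ys) = inversions (c # ys)"
  using assms
proof (induction ys arbitrary: c)
  case (Cons y ys)
  have len: "length (filter Q (carry P d ys)) = length (filter Q (d # ys))" for Q d
    by (metis mset_carry mset_filter size_mset)
  show ?case
  proof (cases "P y")
    case True
    have "inversions (carry P y ys) + length (filter (\<lambda>z. \<not> P z) ys) = inversions (y # ys)"
      by (rule Cons.IH) (simp_all add: Cons.prems True)
    then show ?thesis using True len by simp
  next
    case False
    have "inversions (carry P c ys) + length (filter (\<lambda>z. \<not> P z) ys) = inversions (c # ys)"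
      by (rule Cons.IH) (use Cons.prems in auto)
    moreover have "y < c" using Cons.prems(1)[of c y] Cons.prems(2) False by simp
    moreover from this have "\<not> c < y" by simp
    ultimately show ?thesis using False len by simp
  qed
qed simp

text \<open>
  Prepending \<open>x\<close> creates one inversion for each smaller letter. If \<open>y < x\<close>, the rearrangement
  creates one more for each larger letter, which gives the full length; otherwise it destroys
  one for each smaller letter, and the two effects cancel.
\<close>

lemma inversions_Cons_foata_step:
  assumes "x \<notin> set (y # ys)"
  shows "inversions (x # foata_step x (y # ys))
    = (if y < x then length (y # ys) else 0) + inversions (y # ys)"
proof -
  have len: "length (filter (\<lambda>z. z < x) (foata_step x (y # ys))) = length (filter (\<lambda>z. z < x) (y # ys))"
    by (metis mset_foata_step mset_filter size_mset)
  show ?thesis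
  proof (cases "y < x")
    case True
    have "inversions (carry (\<lambda>z. z < x) y ys)
      = inversions (y # ys) + length (filter (\<lambda>z. \<not> z < x) ys)"
      by (rule inversions_carry_small) (use assms True in auto)
    then show ?thesis
      using True len sum_length_filter_compl[of "\<lambda>z. z < x" ys] by (simp add: foata_step_def)
  next
    case False
    have "inversions (carry (\<lambda>z. x < z) y ys) + length (filter (\<lambda>z. \<not> x < z) ys)
      = inversions (y # ys)"
      by (rule inversions_carry_large) (use assms False in auto)
    moreover have "filter (\<lambda>z. \<not> x < z) ys = filter (\<lambda>z. z < x) ys"
      using assms by (metis (mono_tags, lifting) filter_cong linorder_cases list.set_intros(2) order_less_asym)
    ultimately show ?thesis
      using False len by (simp add: foata_step_def)
  qed
qed

lemma inversions_foata: "distinct xs \<Longrightarrow> inversions (foata xs) = rev_major xs"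
proof (induction xs rule: rev_major.induct)
  case (1 x y xs)
  define zs where "zs = foata_step y (foata xs)"
  have zs: "foata (y # xs) = y # zs" unfolding zs_def by (rule foata.simps)
  have set: "set (y # zs) = set (y # xs)" using set_foata[of "y # xs"] unfolding zs .
  have x: "x \<notin> set (y # zs)" unfolding set using "1.prems" by (simp only: distinct.simps simp_thms)
  have len: "length (y # zs) = length (y # xs)" using length_foata[of "y # xs"] unfolding zs .
  have IH: "inversions (y # zs) = rev_major (y # xs)"
    using "1.IH" "1.prems" unfolding zs distinct.simps(2)[of x] by blast
  have "foata (x # y # xs) = x # foata_step x (y # zs)"
    by (simp only: foata.simps(2)[of x] zs)
  then have "inversions (foata (x # y # xs))
      = (if y < x then length (y # xs) else 0) + rev_major (y # xs)"
    by (simp only: inversions_Cons_foata_step[OF x] len IH)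
  then show ?case by (simp only: rev_major.simps)
next
  case "2_1"
  then show ?case by simp
next
  case ("2_2" v)
  then show ?case by (simp add: foata_step_def)
qed

lemma left_minima_filter: "{y \<in> left_minima v. y < x} = left_minima (filter (\<lambda>z. z < x) v)"
proof (induction v)
  case (Cons a v)
  show ?case
  proof (cases "a < x")
    case True
    then have "{y \<in> left_minima (a # v). y < x} = insert a {y \<in> {y \<in> left_minima v. y < x}. y < a}"
      by auto
    then show ?thesis using True Cons by simp
  next
    case False
    then have "{y \<in> left_minima (a # v). y < x} = {y \<in> left_minima v. y < x}"
      by auto
    then show ?thesis using False Cons by simp
  qed
qed simp

text \<open>
  Whether a letter below \<open>x\<close> is a left-to-right minimum depends only on the subword of the letters
  below \<open>x\<close>, and a step for \<open>x\<close> keeps that subword.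
\<close>

lemma left_minima_foata: "distinct xs \<Longrightarrow> left_minima (foata xs) = left_minima xs"
proof (induction xs)
  case (Cons x xs)
  then have x: "x \<notin> set (foata xs)" by (simp add: set_foata)
  have "left_minima (foata (x # xs)) = insert x {y \<in> left_minima (foata xs). y < x}"
    by (simp only: foata.simps left_minima.simps left_minima_filter filter_foata_step(1)[OF x])
  then show ?case using Cons by simp
qed simp

lemma precedes_filter: "Q a \<Longrightarrow> Q b \<Longrightarrow> precedes (filter Q v) a b = precedes v a b"
  by (induction v) auto

lemma precedes_imp_mem: "precedes v a b \<Longrightarrow> a \<in> set v \<and> b \<in> set v"
  by (induction v) auto

text \<open>
  A step for \<open>x\<close> interchanges only letters that are separated by \<open>x\<close> in value. If no letter lies
  strictly between \<open>a\<close> and \<open>b\<close>, these two are never interchanged.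
\<close>

lemma precedes_foata:
  assumes "distinct xs" "\<And>x. x \<in> set xs \<Longrightarrow> x < a \<and> x < b \<or> x = a \<or> x = b \<or> a < x \<and> b < x"
  shows "precedes (foata xs) a b = precedes xs a b"
  using assms
proof (induction xs)
  case (Cons x xs)
  then have x: "x \<notin> set (foata xs)" by (simp add: set_foata)
  have IH: "precedes (foata xs) a b = precedes xs a b"
    by (rule Cons.IH) (use Cons.prems in simp_all)
  let ?w = "foata_step x (foata xs)"
  consider "x = a" | "x = b" | "x < a" "x < b" | "a < x" "b < x"
    using Cons.prems(2)[of x] by auto
  then show ?case
  proof cases
    case 1
    then have "\<not> precedes ?w a b" "\<not> precedes xs a b"
      using x precedes_imp_mem[of ?w a b] precedes_imp_mem[of xs a b]
      by (auto simp: set_foata_step set_foata)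
    then show ?thesis by (simp add: set_foata_step set_foata)
  next
    case 2
    then have "\<not> precedes ?w a b" "\<not> precedes xs a b"
      using x precedes_imp_mem[of ?w a b] precedes_imp_mem[of xs a b]
      by (auto simp: set_foata_step set_foata)
    then show ?thesis by (simp add: set_foata_step set_foata)
  next
    case 3
    then have "precedes ?w a b = precedes (foata xs) a b"
      using precedes_filter[of "\<lambda>z. x < z" a b] filter_foata_step(2)[OF x] by metis
    then show ?thesis using 3 IH by auto
  next
    case 4
    then have "precedes ?w a b = precedes (foata xs) a b"
      using precedes_filter[of "\<lambda>z. z < x" a b] filter_foata_step(1)[OF x] by metis
    then show ?thesis using 4 IH by auto
  qed
qed simp

section \<open>Truncated inversion codes\<close>

definition larger_left :: "(nat \<Rightarrow> nat) \<Rightarrow> nat \<Rightarrow> nat set" where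
  "larger_left p i = {j \<in> {1..<i}. p j > p i}"

definition smaller_left :: "(nat \<Rightarrow> nat) \<Rightarrow> nat \<Rightarrow> nat set" where
  "smaller_left p i = {j \<in> {1..<i}. p j < p i}"

text \<open>
  For \<open>q = 0\<close> nothing is cut off and this is the inversion code, since fewer than \<open>i\<close> entries
  stand to the left of position \<open>i\<close>. The function is restricted to \<open>{1..m}\<close> so that codes are
  elements of a dependent product.
\<close>

definition cut_code :: "nat \<Rightarrow> nat \<Rightarrow> (nat \<Rightarrow> nat) \<Rightarrow> nat \<Rightarrow> nat" where
  "cut_code q m p = (\<lambda>i\<in>{1..m}. min (i - q) (card (larger_left p i)))"

text \<open>
  For \<open>q = 1\<close> these are the positions of the left-to-right minima. They comprise the first \<open>q\<close>
  positions and \<open>Del_q\<close>; unlike \<open>Del_q\<close>, the set of points \<open>(i, p i)\<close> they determine is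
  transposed when \<open>p\<close> is inverted.
\<close>

definition almost_minima :: "nat \<Rightarrow> nat \<Rightarrow> (nat \<Rightarrow> nat) \<Rightarrow> nat set" where
  "almost_minima q m p = {i \<in> {1..m}. card (smaller_left p i) < q}"

lemma finite_left [simp]: "finite (larger_left p i)" "finite (smaller_left p i)"
  by (simp_all add: larger_left_def smaller_left_def)

lemma card_larger_smaller_left:
  assumes "inj p"
  shows "card (larger_left p i) + card (smaller_left p i) = i - 1"
proof -
  have "larger_left p i \<union> smaller_left p i = {1..<i}"
  proof (rule set_eqI)
    fix j
    have "p j = p i \<Longrightarrow> j = i" by (rule injD[OF assms])
    then show "j \<in> larger_left p i \<union> smaller_left p i \<longleftrightarrow> j \<in> {1..<i}"
      by (cases "p j" "p i" rule: linorder_cases) (auto simp: larger_left_def smaller_left_def)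
  qed
  moreover have "larger_left p i \<inter> smaller_left p i = {}"
    by (auto simp: larger_left_def smaller_left_def)
  ultimately show ?thesis
    by (metis card_Un_disjoint finite_left card_atLeastLessThan)
qed

text \<open>
  As \<open>i - 1\<close> entries stand to the left of position \<open>i\<close>, fewer than \<open>q\<close> smaller ones means at
  least \<open>i - q\<close> larger ones, that is, the truncation is in effect.
\<close>

lemma almost_minima_cut_code:
  assumes "inj p"
  shows "almost_minima q m p = {i \<in> {1..m}. cut_code q m p i = i - q}"
proof -
  have "card (smaller_left p i) < q \<longleftrightarrow> cut_code q m p i = i - q" if "i \<in> {1..m}" for i
    using card_larger_smaller_left[OF assms, of i] that by (auto simp: cut_code_def)
  then show ?thesis by (auto simp: almost_minima_def)
qed

lemma Del_q_cut_code:
  assumes "inj p" "q \<ge> 1"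
  shows "Del_q q m p = {i \<in> {q+1..m}. cut_code q m p i = i - q}"
proof -
  have "x \<le> q - 1 \<longleftrightarrow> x < q" for x using assms(2) by linarith
  then have "Del_q q m p = {i \<in> {q+1..m}. card (smaller_left p i) < q}"
    by (simp only: Del_q_def smaller_left_def)
  also have "\<dots> = {i \<in> {q+1..m}. i \<in> almost_minima q m p}"
    by (rule Collect_cong) (auto simp: almost_minima_def)
  also have "\<dots> = {i \<in> {q+1..m}. cut_code q m p i = i - q}"
    unfolding almost_minima_cut_code[OF assms(1)] by (rule Collect_cong) auto
  finally show ?thesis .
qed

lemma inv_q_cut_code: "inv_q q m p = (\<Sum>i\<in>{q+1..m}. cut_code q m p i)"
  unfolding inv_q_def by (rule sum.cong) (auto simp: cut_code_def larger_left_def)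

lemma larger_left_Suc:
  assumes "inj p" "i \<ge> 1"
  shows "p i > p (i + 1) \<longleftrightarrow> card (larger_left p i) < card (larger_left p (i + 1))"
proof (cases "p i > p (i + 1)")
  case True
  then have "insert i (larger_left p i) \<subseteq> larger_left p (i + 1)"
    using assms(2) by (auto simp: larger_left_def)
  moreover have "i \<notin> larger_left p i" by (simp add: larger_left_def)
  ultimately show ?thesis using True
    using card_mono[OF finite_left(1)[of p "i + 1"], of "insert i (larger_left p i)"] by simp
next
  case False
  then have "p i < p (i + 1)" using injD[OF assms(1), of i "i + 1"]
    by (cases "p i" "p (i + 1)" rule: linorder_cases) simp_all
  then have "larger_left p (i + 1) \<subseteq> larger_left p i"
    by (auto simp: larger_left_def less_Suc_eq)
  then have "card (larger_left p (i + 1)) \<le> card (larger_left p i)"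
    by (rule card_mono[OF finite_left(1)])
  then show ?thesis using False by simp
qed

text \<open>
  A descent is an ascent of the code. Truncation preserves ascents, because the bound grows with
  \<open>i\<close>. Where the code at \<open>i + 1\<close> reaches its bound there always is an ascent after truncation,
  and a new ascent can arise in no other way.
\<close>

lemma Des_q_cut_code:
  assumes "inj p" "q \<ge> 1"
  shows "Des_q q m p = {i \<in> {q..<m}. cut_code q m p i < cut_code q m p (i + 1)}"
proof -
  have "(p i > p (i + 1) \<or> i + 1 \<in> Del_q q m p) \<longleftrightarrow> cut_code q m p i < cut_code q m p (i + 1)"
    if "i \<in> {q..<m}" for i
    using that assms larger_left_Suc[of p i] by (auto simp: Del_q_cut_code cut_code_def)
  then show ?thesis by (auto simp: Des_q_def)
qed

lemma card_smaller_left_mono: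
  assumes "i < j" "1 \<le> i" "p i < p j"
  shows "card (smaller_left p i) \<le> card (smaller_left p j)"
proof -
  have "smaller_left p i \<subseteq> smaller_left p j"
    using assms by (auto simp: smaller_left_def)
  then show ?thesis by (rule card_mono[OF finite_left(2)])
qed

text \<open>
  Whatever is smaller and to the left of a point is so too for every point above and to the right
  of it, so the complement of the almost minima is closed in that direction.
\<close>

lemma northeast_not_almost_minimum:
  assumes "i \<in> {1..m} - almost_minima q m p" "i < j" "p i < p j"
  shows "j \<notin> almost_minima q m p"
  using assms card_smaller_left_mono[of i j p] by (auto simp: almost_minima_def)

text \<open>
  The values above \<open>p i\<close> occur either to the left of position \<open>i\<close> or to the right of it, and in
  the second case not at an almost minimum.
\<close>

lemma card_greater_values:
  assumes p: "p permutes {1..m}" and i: "i \<in> {1..m} - almost_minima q m p"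
  shows "card (larger_left p i) + card {j \<in> {i<..m} - almost_minima q m p. p i < p j} = m - p i"
proof -
  let ?R = "{j \<in> {i<..m} - almost_minima q m p. p i < p j}"
  have "larger_left p i \<union> ?R = {j \<in> {1..m}. p i < p j}"
  proof (rule set_eqI)
    fix j
    show "j \<in> larger_left p i \<union> ?R \<longleftrightarrow> j \<in> {j \<in> {1..m}. p i < p j}"
      using i northeast_not_almost_minimum[OF i, of j]
      by (cases "j < i"; cases "j = i") (auto simp: larger_left_def)
  qed
  moreover have "larger_left p i \<inter> ?R = {}" by (auto simp: larger_left_def)
  moreover have "p ` {j \<in> {1..m}. p i < p j} = {u \<in> p ` {1..m}. p i < u}" by blast
  moreover have "{u \<in> p ` {1..m}. p i < u} = {p i<..m}"
    unfolding permutes_image[OF p] by auto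
  moreover have "card (p ` {j \<in> {1..m}. p i < p j}) = card {j \<in> {1..m}. p i < p j}"
    by (rule card_image) (rule permutes_inj_on[OF p])
  ultimately show ?thesis
    using card_Un_disjoint[of "larger_left p i" ?R] by simp
qed

lemma count_above_eq_imp_mem_image:
  fixes f :: "'a \<Rightarrow> nat"
  assumes J: "finite J" "inj_on f J" and "v < w" "w \<le> m"
    and v: "a + card {j \<in> J. v < f j} = m - v" and w: "a + card {j \<in> J. w < f j} = m - w"
  shows "w \<in> f ` J"
proof -
  let ?K = "{j \<in> J. v < f j \<and> f j \<le> w}"
  have "{j \<in> J. v < f j} = ?K \<union> {j \<in> J. w < f j}" using \<open>v < w\<close> by auto
  moreover have "?K \<inter> {j \<in> J. w < f j} = {}" by auto
  ultimately have "card {j \<in> J. v < f j} = card ?K + card {j \<in> J. w < f j}"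
    using card_Un_disjoint[of ?K "{j \<in> J. w < f j}"] J(1) by simp
  then have "card ?K = w - v" using assms by linarith
  moreover have "inj_on f ?K" using J(2) by (rule inj_on_subset) auto
  ultimately have "card (f ` ?K) = card {v<..w}" by (simp add: card_image)
  moreover have "f ` ?K \<subseteq> {v<..w}" by auto
  ultimately have "f ` ?K = {v<..w}" by (intro card_subset_eq) simp_all
  moreover have "w \<in> {v<..w}" using \<open>v < w\<close> by simp
  ultimately show ?thesis by blast
qed

lemma almost_minima_cong:
  assumes "p permutes {1..m}" "p' permutes {1..m}" "cut_code q m p = cut_code q m p'"
  shows "almost_minima q m p = almost_minima q m p'"
  using assms by (simp add: almost_minima_cut_code permutes_inj)

lemma cut_code_not_almost_minimum:
  assumes p: "p permutes {1..m}" and i: "i \<in> {1..m} - almost_minima q m p"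
  shows "cut_code q m p i = card (larger_left p i)"
  using i by (auto simp: almost_minima_cut_code permutes_inj[OF p] cut_code_def)

text \<open>
  The values at the other positions can be read off from right to left: by the previous counting
  lemma the code at \<open>i\<close> tells how many of the values not yet used at such positions exceed \<open>p i\<close>.
  Two candidates with the same count cannot differ, since the larger one would already be used.
\<close>

lemma cut_code_determines_values:
  assumes p: "p permutes {1..m}" and p': "p' permutes {1..m}"
    and eq: "cut_code q m p = cut_code q m p'"
    and i: "i \<in> {1..m} - almost_minima q m p"
  shows "p i = p' i"
  using i
proof (induction "m - i" arbitrary: i rule: less_induct)
  case less
  let ?A = "almost_minima q m p"
  let ?J = "{i<..m} - ?A"
  note A' = almost_minima_cong[OF p p' eq]
  have later: "p j = p' j" if "j \<in> ?J" for j
    by (rule less.hyps) (use that less.prems in auto)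
  have left: "card (larger_left p' i) = card (larger_left p i)"
    using cut_code_not_almost_minimum[OF p less.prems]
      cut_code_not_almost_minimum[OF p' less.prems[unfolded A']] eq by simp
  have "{j \<in> ?J. p' i < p' j} = {j \<in> ?J. p' i < p j}"
    by (rule Collect_cong, rule conj_cong[OF refl]) (simp only: later)
  then have c': "card (larger_left p i) + card {j \<in> ?J. p' i < p j} = m - p' i"
    using card_greater_values[OF p' less.prems[unfolded A']] left
    by (simp add: A')
  have c: "card (larger_left p i) + card {j \<in> ?J. p i < p j} = m - p i"
    by (rule card_greater_values[OF p less.prems])
  have le: "p i \<le> m" "p' i \<le> m"
    using less.prems permutes_in_image[OF p, of i] permutes_in_image[OF p', of i] by auto
  have J: "finite ?J" "inj_on p ?J" using permutes_inj_on[OF p] by auto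
  show ?case
  proof (rule linorder_cases[of "p i" "p' i"])
    assume "p i < p' i"
    then obtain j where "j \<in> ?J" "p' i = p j"
      using count_above_eq_imp_mem_image[OF J _ le(2) c c'] by blast
    then have "p' i = p' j" "i < j" using later by auto
    then show ?thesis using injD[OF permutes_inj[OF p']] by blast
  next
    assume "p' i < p i"
    then obtain j where "j \<in> ?J" "p i = p j"
      using count_above_eq_imp_mem_image[OF J _ le(1) c' c] by blast
    then have "p i = p j" "i < j" by auto
    then show ?thesis using injD[OF permutes_inj[OF p]] by blast
  qed
qed

text \<open>
  The almost minima enter the code of another position only through their set of values: an almost
  minimum with value above \<open>p i\<close> must stand to the left of \<open>i\<close>.
\<close>

lemma card_larger_left_not_almost_minimum:
  assumes p: "p permutes {1..m}" and i: "i \<in> {1..m} - almost_minima q m p"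
  shows "card (larger_left p i) = card {j \<in> {1..<i} - almost_minima q m p. p i < p j}
    + card {u \<in> p ` almost_minima q m p. p i < u}"
proof -
  let ?A = "almost_minima q m p"
  have "larger_left p i = {j \<in> {1..<i} - ?A. p i < p j} \<union> {j \<in> ?A. p i < p j}"
  proof (rule set_eqI)
    fix j
    have "j \<in> ?A \<Longrightarrow> 1 \<le> j" by (simp add: almost_minima_def)
    then show "j \<in> larger_left p i \<longleftrightarrow> j \<in> {j \<in> {1..<i} - ?A. p i < p j} \<union> {j \<in> ?A. p i < p j}"
      using i northeast_not_almost_minimum[OF i, of j]
      by (cases "j < i"; cases "j = i") (auto simp: larger_left_def)
  qed
  moreover have "{j \<in> {1..<i} - ?A. p i < p j} \<inter> {j \<in> ?A. p i < p j} = {}" by auto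
  moreover have "finite {j \<in> ?A. p i < p j}" by (simp add: almost_minima_def)
  ultimately have "card (larger_left p i)
      = card {j \<in> {1..<i} - ?A. p i < p j} + card {j \<in> ?A. p i < p j}"
    by (simp add: card_Un_disjoint)
  moreover have "{u \<in> p ` ?A. p i < u} = p ` {j \<in> ?A. p i < p j}" by blast
  moreover have "card (p ` {j \<in> ?A. p i < p j}) = card {j \<in> ?A. p i < p j}"
    by (rule card_image) (rule permutes_inj_on[OF p])
  ultimately show ?thesis by simp
qed

lemma image_almost_minima:
  assumes p: "p permutes {1..m}"
  shows "p ` almost_minima q m p = {1..m} - p ` ({1..m} - almost_minima q m p)"
proof -
  have "almost_minima q m p = {1..m} - ({1..m} - almost_minima q m p)"
    by (auto simp: almost_minima_def)
  then show ?thesis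
    using image_set_diff[OF permutes_inj[OF p], of "{1..m}" "{1..m} - almost_minima q m p"]
    unfolding permutes_image[OF p] by simp
qed

text \<open>
  Converse to the reconstruction of the values. At an almost minimum the code is cut off to \<open>i - q\<close>;
  elsewhere the preceding count applies, and the values taken at the almost minima are those left
  over by the other positions.
\<close>

lemma cut_code_eqI:
  assumes p: "p permutes {1..m}" and p': "p' permutes {1..m}"
    and A: "almost_minima q m p = almost_minima q m p'"
    and eq: "\<And>i. i \<in> {1..m} - almost_minima q m p \<Longrightarrow> p i = p' i"
  shows "cut_code q m p = cut_code q m p'"
proof (rule ext)
  fix i
  let ?A = "almost_minima q m p"
  consider "i \<notin> {1..m}" | "i \<in> ?A" | "i \<in> {1..m} - ?A" by blast
  then show "cut_code q m p i = cut_code q m p' i"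
  proof cases
    case 1
    then show ?thesis by (auto simp: cut_code_def)
  next
    case 2
    moreover from this A have "i \<in> almost_minima q m p'" by simp
    ultimately show ?thesis by (simp add: almost_minima_cut_code permutes_inj[OF p] permutes_inj[OF p'])
  next
    case 3
    have not_min': "i \<in> {1..m} - almost_minima q m p'" using 3 A by simp
    have "p ` ({1..m} - ?A) = p' ` ({1..m} - ?A)" using eq by (intro image_cong) auto
    then have "p ` ?A = p' ` almost_minima q m p'"
      unfolding image_almost_minima[OF p] image_almost_minima[OF p'] by (simp only: A)
    moreover have "{j \<in> {1..<i} - ?A. p i < p j} = {j \<in> {1..<i} - ?A. p' i < p' j}"
    proof (rule Collect_cong, rule conj_cong[OF refl])
      fix j assume "j \<in> {1..<i} - ?A"
      then have "p j = p' j" using 3 by (intro eq) auto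
      then show "p i < p j \<longleftrightarrow> p' i < p' j" using eq[OF 3] by simp
    qed
    ultimately have "card (larger_left p i) = card (larger_left p' i)"
      unfolding card_larger_left_not_almost_minimum[OF p 3]
        card_larger_left_not_almost_minimum[OF p' not_min'] A[symmetric]
      using eq[OF 3] by simp
    then show ?thesis
      using cut_code_not_almost_minimum[OF p 3] cut_code_not_almost_minimum[OF p' not_min'] by simp
  qed
qed

lemma almost_minima_inv:
  assumes p: "p permutes {1..m}"
  shows "almost_minima q m (inv p) = p ` almost_minima q m p"
proof -
  have "card (smaller_left (inv p) (p i)) = card (smaller_left p i)" if i: "i \<in> {1..m}" for i
  proof -
    have "smaller_left (inv p) (p i) = p ` smaller_left p i"
    proof (intro set_eqI iffI)
      fix u assume u: "u \<in> smaller_left (inv p) (p i)"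
      then have "u \<in> {1..m}"
        using permutes_in_image[OF p, of i] i by (auto simp: smaller_left_def)
      then have "inv p u \<in> {1..m}" using permutes_in_image[OF permutes_inv[OF p]] by blast
      then have "inv p u \<in> smaller_left p i"
        using u by (auto simp: smaller_left_def permutes_inverses[OF p])
      then show "u \<in> p ` smaller_left p i"
        using imageI[of "inv p u" "smaller_left p i" p] by (simp add: permutes_inverses(1)[OF p])
    next
      fix u assume "u \<in> p ` smaller_left p i"
      then obtain j where j: "u = p j" "j \<in> smaller_left p i" by blast
      then have "p j \<in> {1..m}"
        using i permutes_in_image[OF p, of j] by (auto simp: smaller_left_def)
      then show "u \<in> smaller_left (inv p) (p i)"
        using j by (auto simp: smaller_left_def permutes_inverses[OF p])
    qed
    then show ?thesis by (simp add: card_image permutes_inj_on[OF p])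
  qed
  then have "almost_minima q m (inv p) = {v \<in> p ` {1..m}. v \<in> p ` almost_minima q m p}"
    unfolding almost_minima_def using injD[OF permutes_inj[OF p]]
    by (subst permutes_image[OF p, symmetric]) auto
  then show ?thesis by (auto simp: almost_minima_def)
qed

text \<open>
  By the two preceding results the truncated code amounts to the set of points \<open>(i, p i)\<close>, for \<open>i\<close>
  not an almost minimum, and this set is merely transposed by inversion.
\<close>

lemma cut_code_inv:
  assumes p: "p permutes {1..m}" and p': "p' permutes {1..m}"
    and eq: "cut_code q m p = cut_code q m p'"
  shows "cut_code q m (inv p) = cut_code q m (inv p')"
proof -
  let ?C = "{1..m} - almost_minima q m p"
  have same: "p i = p' i" if "i \<in> ?C" for i
    using cut_code_determines_values[OF p p' eq that] .
  then have im: "p ` ?C = p' ` ?C" by (intro image_cong) auto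
  have A: "almost_minima q m (inv p) = {1..m} - p ` ?C"
    using almost_minima_inv[OF p] image_almost_minima[OF p] by simp
  also have "\<dots> = almost_minima q m (inv p')"
    using almost_minima_inv[OF p'] image_almost_minima[OF p'] almost_minima_cong[OF p p' eq] im
    by simp
  finally have "almost_minima q m (inv p) = almost_minima q m (inv p')" .
  moreover have "inv p v = inv p' v" if "v \<in> {1..m} - almost_minima q m (inv p)" for v
  proof -
    have "v \<in> p ` ?C" using that unfolding A by blast
    then obtain i where i: "v = p i" "i \<in> ?C" by blast
    then have "v = p' i" using same by simp
    then show ?thesis
      using i(1) permutes_inverses(2)[OF p, of i] permutes_inverses(2)[OF p', of i] by simp
  qed
  ultimately show ?thesis
    by (rule cut_code_eqI[OF permutes_inv[OF p] permutes_inv[OF p']])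
qed

section \<open>Sizes of the fibres of the truncated code\<close>

lemma finite_perms: "finite {p. p permutes {a..b::nat}}"
  by (rule finite_permutations) simp

lemma card_larger_left_less: "1 \<le> i \<Longrightarrow> card (larger_left p i) < i"
  using card_mono[of "{1..<i}" "larger_left p i"] by (force simp: larger_left_def)

lemma cut_code_0: "i \<in> {1..m} \<Longrightarrow> cut_code 0 m p i = card (larger_left p i)"
  using card_larger_left_less[of i p] by (simp add: cut_code_def)

lemma cut_code_eq_min: "cut_code q m p = (\<lambda>i\<in>{1..m}. min (i - q) (cut_code 0 m p i))"
  unfolding cut_code_def[of q] by (rule restrict_ext) (simp add: cut_code_0)

text \<open>
  With \<open>q = 0\<close> there are no almost minima, so the reconstruction of values recovers the whole
  permutation from its inversion code; surjectivity follows by counting.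
\<close>

lemma bij_betw_code:
  "bij_betw (cut_code 0 m) {p. p permutes {1..m}} (\<Pi>\<^sub>E i\<in>{1..m}. {..<i})"
proof -
  have inj: "inj_on (cut_code 0 m) {p. p permutes {1..m}}"
  proof (rule inj_onI)
    fix p p' assume "p \<in> {p. p permutes {1..m}}" "p' \<in> {p. p permutes {1..m}}"
      and eq: "cut_code 0 m p = cut_code 0 m p'"
    then have p: "p permutes {1..m}" "p' permutes {1..m}" by auto
    show "p = p'"
    proof (rule ext)
      fix i
      show "p i = p' i"
      proof (cases "i \<in> {1..m}")
        case True
        then have "i \<in> {1..m} - almost_minima 0 m p" by (simp add: almost_minima_def)
        then show ?thesis by (rule cut_code_determines_values[OF p eq])
      next
        case False
        then show ?thesis using p by (simp add: permutes_not_in)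
      qed
    qed
  qed
  moreover have "cut_code 0 m ` {p. p permutes {1..m}} = (\<Pi>\<^sub>E i\<in>{1..m}. {..<i})"
  proof (rule card_subset_eq)
    show "finite (\<Pi>\<^sub>E i\<in>{1..m}. {..<i})" by (intro finite_PiE) simp_all
    show "cut_code 0 m ` {p. p permutes {1..m}} \<subseteq> (\<Pi>\<^sub>E i\<in>{1..m}. {..<i})"
    proof (rule image_subsetI, rule PiE_I)
      fix p i assume "i \<in> {1..m}"
      then show "cut_code 0 m p i \<in> {..<i}" using card_larger_left_less[of i p] by (simp add: cut_code_0)
    next
      fix p and i :: nat assume "i \<notin> {1..m}"
      then show "cut_code 0 m p i = undefined" by (auto simp: cut_code_def)
    qed
    have "card (cut_code 0 m ` {p. p permutes {1..m}}) = fact m"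
      unfolding card_image[OF inj] using card_permutations[of "{1..m}" m] by simp
    also have "\<dots> = card (\<Pi>\<^sub>E i\<in>{1..m}. {..<i})"
      by (simp add: card_PiE fact_prod)
    finally show "card (cut_code 0 m ` {p. p permutes {1..m}}) = card (\<Pi>\<^sub>E i\<in>{1..m}. {..<i})" .
  qed
  ultimately show ?thesis by (simp add: bij_betw_def)
qed

text \<open>
  The fibre is a product, since permutations correspond to codes. At a position \<open>i \<le> q\<close> every entry
  is truncated to \<open>0\<close>, which gives the factor \<open>i\<close>. Beyond \<open>q\<close> the entry is determined by its
  truncation, unless that is \<open>i - q\<close>, when it may be any of the \<open>q\<close> numbers from \<open>i - q\<close> to \<open>i - 1\<close>.
\<close>

lemma card_cut_code_fibre:
  assumes p0: "p0 permutes {1..m}" and q: "1 \<le> q" "q \<le> m"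
  shows "card {p. p permutes {1..m} \<and> cut_code q m p = cut_code q m p0}
    = fact q * q ^ card (Del_q q m p0)"
proof -
  let ?c = "cut_code q m p0"
  let ?S = "{p. p permutes {1..m}}"
  let ?X = "\<lambda>i. {x \<in> {..<i}. min (i - q) x = ?c i}"
  have "cut_code 0 m ` {p \<in> ?S. cut_code q m p = ?c}
      = {a \<in> cut_code 0 m ` ?S. (\<lambda>i\<in>{1..m}. min (i - q) (a i)) = ?c}"
    unfolding cut_code_eq_min[of q m] by blast
  also have "\<dots> = {a \<in> (\<Pi>\<^sub>E i\<in>{1..m}. {..<i}). (\<lambda>i\<in>{1..m}. min (i - q) (a i)) = ?c}"
    using bij_betw_code[of m] by (simp add: bij_betw_def)
  also have "\<dots> = (\<Pi>\<^sub>E i\<in>{1..m}. ?X i)"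
  proof -
    have "(\<lambda>i\<in>{1..m}. min (i - q) (a i)) = ?c \<longleftrightarrow> (\<forall>i\<in>{1..m}. min (i - q) (a i) = ?c i)" for a
    proof
      assume eq: "(\<lambda>i\<in>{1..m}. min (i - q) (a i)) = ?c"
      show "\<forall>i\<in>{1..m}. min (i - q) (a i) = ?c i"
      proof
        fix i assume "i \<in> {1..m}"
        then show "min (i - q) (a i) = ?c i" using fun_cong[OF eq, of i] by simp
      qed
    next
      assume "\<forall>i\<in>{1..m}. min (i - q) (a i) = ?c i"
      then show "(\<lambda>i\<in>{1..m}. min (i - q) (a i)) = ?c"
        by (intro ext) (auto simp: cut_code_def)
    qed
    then show ?thesis by (auto simp: PiE_iff extensional_def)
  qed
  finally have "card (cut_code 0 m ` {p \<in> ?S. cut_code q m p = ?c}) = (\<Prod>i\<in>{1..m}. card (?X i))"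
    by (simp add: card_PiE)
  moreover have "inj_on (cut_code 0 m) {p \<in> ?S. cut_code q m p = ?c}"
    by (rule inj_on_subset[OF bij_betw_imp_inj_on[OF bij_betw_code]]) auto
  ultimately have "card {p \<in> ?S. cut_code q m p = ?c} = (\<Prod>i\<in>{1..m}. card (?X i))"
    by (simp add: card_image)
  also have "\<dots> = (\<Prod>i\<in>{1..q}. card (?X i)) * (\<Prod>i\<in>{q+1..m}. card (?X i))"
    using q prod.ub_add_nat[of 1 q "\<lambda>i. card (?X i)" "m - q"] by simp
  also have "(\<Prod>i\<in>{1..q}. card (?X i)) = (\<Prod>i\<in>{1..q}. i)"
  proof (rule prod.cong)
    fix i assume "i \<in> {1..q}"
    then have "?X i = {..<i}" using q by (auto simp: cut_code_def)
    then show "card (?X i) = i" by simp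
  qed simp
  also have "(\<Prod>i\<in>{1..q}. i) = fact q" by (simp add: fact_prod)
  also have "(\<Prod>i\<in>{q+1..m}. card (?X i)) = (\<Prod>i\<in>{q+1..m}. if i \<in> Del_q q m p0 then q else 1)"
  proof (rule prod.cong)
    fix i assume i: "i \<in> {q+1..m}"
    have Del: "i \<in> Del_q q m p0 \<longleftrightarrow> ?c i = i - q"
      using i unfolding Del_q_cut_code[OF permutes_inj[OF p0] q(1)] by simp
    have le: "?c i \<le> i - q" using i by (simp add: cut_code_def)
    show "card (?X i) = (if i \<in> Del_q q m p0 then q else 1)"
    proof (cases "?c i = i - q")
      case True
      then have "?X i = {i - q..<i}" by auto
      then show ?thesis using True Del i by simp
    next
      case False
      then have "?X i = {?c i}" using le i q by auto
      then show ?thesis using False Del by simp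
    qed
  qed simp
  also have "\<dots> = q ^ card (Del_q q m p0)"
  proof -
    have "{i \<in> {q+1..m}. i \<in> Del_q q m p0} = Del_q q m p0" by (auto simp: Del_q_def)
    then show ?thesis by (simp add: prod.If_cases Int_def)
  qed
  finally show ?thesis by simp
qed

section \<open>A transversal of the fibres\<close>

lemma permutes_upper:
  fixes q m :: nat
  assumes "t permutes {q..m}" "1 \<le> q"
  shows "t permutes {1..m}"
  by (rule permutes_subset[OF assms(1)]) (use assms(2) in auto)

text \<open>
  A permutation of \<open>{q..m}\<close> starts with the fixed points \<open>1, \<dots>, q - 1\<close>, which exceed nothing to
  their right. Hence its inversion code obeys the bounds \<open>i - q\<close> by itself.
\<close>

lemma larger_left_upper:
  assumes t: "t permutes {q..m}" and q: "1 \<le> q"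
  shows "larger_left t i = {j \<in> {q..<i}. t i < t j}"
proof -
  have "q \<le> j" if "j < i" "t i < t j" for j
  proof (rule ccontr)
    assume "\<not> q \<le> j"
    then have "t j = j" using t by (simp add: permutes_not_in)
    then have "t i < j" using that by simp
    then have "t i \<notin> {q..m}" using \<open>\<not> q \<le> j\<close> by simp
    then have "t i = i" using permutes_in_image[OF t, of i] permutes_not_in[OF t, of i] by blast
    then show False using \<open>t i < j\<close> that by simp
  qed
  then have "q \<le> j \<and> 1 \<le> j" if "j < i" "t i < t j" for j
    using that q by (meson le_trans)
  then show ?thesis by (auto simp: larger_left_def)
qed

lemma cut_code_upper:
  assumes t: "t permutes {q..m}" and q: "1 \<le> q" and i: "i \<in> {1..m}"
  shows "cut_code q m t i = card (larger_left t i)"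
proof -
  have "card (larger_left t i) \<le> card {q..<i}"
    unfolding larger_left_upper[OF t q] by (rule card_mono) auto
  then show ?thesis using i by (simp add: cut_code_def)
qed

lemma prod_truncated_lengths: "1 \<le> q \<Longrightarrow> (\<Prod>i\<in>{1..m}. Suc (i - q)) = fact (Suc m - q)"
proof (induction m)
  case (Suc m)
  then have "(\<Prod>i\<in>{1..Suc m}. Suc (i - q)) = fact (Suc m - q) * Suc (Suc m - q)" by simp
  also have "\<dots> = fact (Suc (Suc m) - q)"
    by (cases "q \<le> Suc m") (simp_all add: Suc_diff_le)
  finally show ?case .
qed simp

text \<open>
  So the permutations of \<open>{q..m}\<close> form a transversal of the fibres: on them the truncated code is
  the full code, hence injective, and there are as many of them as truncated codes.
\<close>

lemma bij_betw_cut_code_upper: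
  assumes q: "1 \<le> q" "q \<le> m"
  shows "bij_betw (cut_code q m) {t. t permutes {q..m}} (\<Pi>\<^sub>E i\<in>{1..m}. {..i - q})"
proof -
  let ?T = "{t. t permutes {q..m}}"
  have inj: "inj_on (cut_code q m) ?T"
  proof (rule inj_onI)
    fix t t' assume T: "t \<in> ?T" "t' \<in> ?T" and eq: "cut_code q m t = cut_code q m t'"
    have "cut_code 0 m t = cut_code 0 m t'"
    proof
      fix i
      show "cut_code 0 m t i = cut_code 0 m t' i"
        using T q fun_cong[OF eq, of i]
        by (cases "i \<in> {1..m}") (auto simp: cut_code_0 cut_code_upper cut_code_def[of 0])
    qed
    moreover have "t permutes {1..m}" "t' permutes {1..m}"
      using T by (simp_all only: mem_Collect_eq permutes_upper[OF _ q(1)])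
    ultimately show "t = t'"
      using bij_betw_imp_inj_on[OF bij_betw_code[of m]] by (auto dest: inj_onD)
  qed
  moreover have "cut_code q m ` ?T = (\<Pi>\<^sub>E i\<in>{1..m}. {..i - q})"
  proof (rule card_subset_eq)
    show "finite (\<Pi>\<^sub>E i\<in>{1..m}. {..i - q})" by (intro finite_PiE) simp_all
    show "cut_code q m ` ?T \<subseteq> (\<Pi>\<^sub>E i\<in>{1..m}. {..i - q})"
      by (rule image_subsetI, rule PiE_I) (auto simp: cut_code_def)
    have "card (cut_code q m ` ?T) = fact (Suc m - q)"
      unfolding card_image[OF inj] using card_permutations[of "{q..m}" "Suc m - q"] by simp
    also have "\<dots> = card (\<Pi>\<^sub>E i\<in>{1..m}. {..i - q})"
      using prod_truncated_lengths[OF q(1), of m] by (simp add: card_PiE)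
    finally show "card (cut_code q m ` ?T) = card (\<Pi>\<^sub>E i\<in>{1..m}. {..i - q})" .
  qed
  ultimately show ?thesis by (simp add: bij_betw_def)
qed

lemma sum_over_transversal:
  fixes G :: "(nat \<Rightarrow> nat) \<Rightarrow> 'a::comm_semiring_1"
  assumes q: "1 \<le> q" "q \<le> m"
    and G: "\<And>p p'. p permutes {1..m} \<Longrightarrow> p' permutes {1..m} \<Longrightarrow>
              cut_code q m p = cut_code q m p' \<Longrightarrow> G p = G p'"
  shows "(\<Sum>p | p permutes {1..m}. G p)
    = (\<Sum>t | t permutes {q..m}. of_nat (fact q * q ^ card (Del_q q m t)) * G t)"
proof -
  let ?S = "{p. p permutes {1..m}}" and ?T = "{t. t permutes {q..m}}"
  let ?C = "\<Pi>\<^sub>E i\<in>{1..m}. {..i - q}"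
  have "cut_code q m ` ?S \<subseteq> ?C"
    by (rule image_subsetI, rule PiE_I) (auto simp: cut_code_def)
  moreover have "finite ?C" by (intro finite_PiE) simp_all
  ultimately have "(\<Sum>p\<in>?S. G p) = (\<Sum>c\<in>?C. \<Sum>p\<in>{p \<in> ?S. cut_code q m p = c}. G p)"
    by (intro sum.group[symmetric] finite_perms)
  also have "\<dots> = (\<Sum>t\<in>?T. \<Sum>p\<in>{p \<in> ?S. cut_code q m p = cut_code q m t}. G p)"
    by (rule sum.reindex_bij_betw[OF bij_betw_cut_code_upper[OF q], symmetric])
  also have "\<dots> = (\<Sum>t\<in>?T. of_nat (fact q * q ^ card (Del_q q m t)) * G t)"
  proof (rule sum.cong)
    fix t assume "t \<in> ?T"
    then have t: "t permutes {1..m}" by (simp only: mem_Collect_eq permutes_upper[OF _ q(1)])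
    have "(\<Sum>p\<in>{p \<in> ?S. cut_code q m p = cut_code q m t}. G p)
        = (\<Sum>p\<in>{p \<in> ?S. cut_code q m p = cut_code q m t}. G t)"
    proof (rule sum.cong[OF refl])
      fix p assume "p \<in> {p \<in> ?S. cut_code q m p = cut_code q m t}"
      then show "G p = G t" by (intro G t) simp_all
    qed
    also have "\<dots> = of_nat (card {p. p permutes {1..m} \<and> cut_code q m p = cut_code q m t}) * G t"
      by simp
    finally show "(\<Sum>p\<in>{p \<in> ?S. cut_code q m p = cut_code q m t}. G p)
        = of_nat (fact q * q ^ card (Del_q q m t)) * G t"
      unfolding card_cut_code_fibre[OF t q] .
  qed simp
  finally show ?thesis .
qed

section \<open>The transversal as a set of words\<close>

abbreviation word :: "nat \<Rightarrow> nat \<Rightarrow> (nat \<Rightarrow> nat) \<Rightarrow> nat list" where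
  "word k m p \<equiv> map p [k..<Suc m]"

lemma inversions_snoc: "inversions (xs @ [y]) = inversions xs + length (filter (\<lambda>x. y < x) xs)"
  by (induction xs) auto

lemma inversions_word:
  "inversions (word q m p) = (\<Sum>i\<in>{q+1..m}. card {j \<in> {q..<i}. p i < p j})"
proof (induction m)
  case 0
  then show ?case by (cases q) auto
next
  case (Suc m)
  show ?case
  proof (cases "q \<le> Suc m")
    case True
    have "length (filter (\<lambda>j. p (Suc m) < p j) [q..<Suc m]) = card {j \<in> {q..<Suc m}. p (Suc m) < p j}"
      using distinct_length_filter[of "[q..<Suc m]" "\<lambda>j. p (Suc m) < p j"]
      by (simp add: Int_def conj_commute del: upt_Suc)
    moreover have "word q (Suc m) p = word q m p @ [p (Suc m)]" using True by simp
    ultimately have step: "inversions (word q (Suc m) p)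
        = inversions (word q m p) + card {j \<in> {q..<Suc m}. p (Suc m) < p j}"
      by (simp only: inversions_snoc filter_map length_map o_def)
    show ?thesis
    proof (cases "q = Suc m")
      case True
      then show ?thesis by simp
    next
      case False
      then have "{q+1..Suc m} = insert (Suc m) {q+1..m}" using True by auto
      then show ?thesis using step Suc by simp
    qed
  next
    case False
    then show ?thesis by simp
  qed
qed

lemma word_Cons: "k \<le> m \<Longrightarrow> word k m p = p k # word (Suc k) m p"
  by (simp only: upt_conv_Cons less_Suc_eq_le list.map)

lemma length_word: "length (word k m p) = Suc m - k"
  by (simp only: length_map length_upt)

lemma word_induct [case_names Nil Cons]:
  fixes k m :: nat
  assumes "\<And>k. m < k \<Longrightarrow> P k" "\<And>k. k \<le> m \<Longrightarrow> P (Suc k) \<Longrightarrow> P k"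
  shows "P k"
proof (induction "Suc m - k" arbitrary: k)
  case 0
  then show ?case by (simp add: assms(1))
next
  case (Suc n)
  have "P (Suc k)" by (rule Suc.hyps(1)) (use Suc.hyps(2) in simp)
  moreover have "k \<le> m" using Suc.hyps(2) by simp
  ultimately show ?case by (rule assms(2)[rotated])
qed

lemma rev_major_word:
  "rev_major (word k m p) = (\<Sum>i\<in>{i \<in> {k..<m}. p (i + 1) < p i}. m - i)"
proof (induction k rule: word_induct[of m])
  case (Nil k)
  then show ?case by simp
next
  case (Cons k)
  show ?case
  proof (cases "k = m")
    case True
    then show ?thesis by simp
  next
    case False
    then have k: "k < m" using Cons by simp
    have w: "word k m p = p k # p (Suc k) # word (Suc (Suc k)) m p"
      "word (Suc k) m p = p (Suc k) # word (Suc (Suc k)) m p"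
      using k by (simp_all only: word_Cons less_imp_le Suc_le_eq)
    have len: "length (word (Suc k) m p) = m - k" by (simp only: length_word diff_Suc_Suc)
    have "rev_major (word k m p)
        = (if p (Suc k) < p k then m - k else 0) + rev_major (word (Suc k) m p)"
      by (simp only: w rev_major.simps len[unfolded w])
    also have "rev_major (word (Suc k) m p)
        = (\<Sum>i\<in>{i \<in> {Suc k..<m}. p (i + 1) < p i}. m - i)"
      by (rule Cons.IH)
    also have "(if p (Suc k) < p k then m - k else 0) + \<dots>
        = (\<Sum>i\<in>{i \<in> {k..<m}. p (i + 1) < p i}. m - i)"
    proof (cases "p (Suc k) < p k")
      case True
      then have "{i \<in> {k..<m}. p (i + 1) < p i} = insert k {i \<in> {Suc k..<m}. p (i + 1) < p i}"
        using k by (auto simp: le_less Suc_le_eq)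
      then show ?thesis using True by simp
    next
      case False
      have "i \<noteq> k" if "p (i + 1) < p i" for i using that False by auto
      then have "{i \<in> {k..<m}. p (i + 1) < p i} = {i \<in> {Suc k..<m}. p (i + 1) < p i}"
        by (intro Collect_cong) (metis atLeastLessThan_iff le_less not_less_eq_eq Suc_leD Suc_le_eq)
      then show ?thesis using False by simp
    qed
    finally show ?thesis .
  qed
qed

lemma left_minima_word:
  "left_minima (word k m p) = p ` {i \<in> {k..m}. \<forall>j\<in>{k..<i}. p i < p j}"
proof (induction k rule: word_induct[of m])
  case (Nil k)
  then show ?case by simp
next
  case (Cons k)
  let ?P = "\<lambda>k. {i \<in> {k..m}. \<forall>j\<in>{k..<i}. p i < p j}"
  have "?P k = insert k {i \<in> ?P (Suc k). p i < p k}"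
  proof (rule set_eqI)
    fix i
    consider "i < k" | "i = k" | "k < i" by linarith
    then show "i \<in> ?P k \<longleftrightarrow> i \<in> insert k {i \<in> ?P (Suc k). p i < p k}"
    proof cases
      case 3
      then have "{k..<i} = insert k {Suc k..<i}" by auto
      then show ?thesis using 3 by auto
    qed (use Cons.hyps in auto)
  qed
  moreover have "left_minima (word k m p) = insert (p k) {y \<in> p ` ?P (Suc k). y < p k}"
    using Cons by (simp only: word_Cons left_minima.simps)
  moreover have "{y \<in> p ` ?P (Suc k). y < p k} = p ` {i \<in> ?P (Suc k). p i < p k}" by blast
  ultimately show ?case by (simp only: image_insert)
qed

lemma set_word: "set (word k m p) = p ` {k..m}"
  by (simp only: set_map set_upt atLeastLessThanSuc_atLeastAtMost)

lemma precedes_word: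
  "precedes (word k m p) a b \<longleftrightarrow> (\<exists>i j. k \<le> i \<and> i < j \<and> j \<le> m \<and> p i = a \<and> p j = b)"
proof (induction k rule: word_induct[of m])
  case (Nil k)
  then show ?case by auto
next
  case (Cons k)
  have "precedes (word k m p) a b
      \<longleftrightarrow> p k = a \<and> b \<in> p ` {Suc k..m} \<or> precedes (word (Suc k) m p) a b"
    using Cons.hyps by (simp only: word_Cons precedes.simps set_word)
  also have "\<dots> \<longleftrightarrow> (\<exists>i j. k \<le> i \<and> i < j \<and> j \<le> m \<and> p i = a \<and> p j = b)" (is "_ \<longleftrightarrow> ?R")
  proof
    assume "p k = a \<and> b \<in> p ` {Suc k..m} \<or> precedes (word (Suc k) m p) a b"
    then show ?R
    proof
      assume "p k = a \<and> b \<in> p ` {Suc k..m}"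
      then obtain j where "p k = a" "p j = b" "k < j" "j \<le> m" by auto
      then show ?R by blast
    next
      assume "precedes (word (Suc k) m p) a b"
      then show ?R using Cons.IH Suc_leD by blast
    qed
  next
    assume ?R
    then obtain i j where ij: "k \<le> i" "i < j" "j \<le> m" "p i = a" "p j = b" by blast
    show "p k = a \<and> b \<in> p ` {Suc k..m} \<or> precedes (word (Suc k) m p) a b"
    proof (cases "i = k")
      case True
      then show ?thesis using ij by auto
    next
      case False
      then have "Suc k \<le> i" using ij by simp
      then show ?thesis using Cons.IH ij by blast
    qed
  qed
  finally show ?case .
qed

lemma bij_betw_word:
  assumes "1 \<le> q" "q \<le> m"
  shows "bij_betw (word q m) {t. t permutes {q..m}} (permutations_of_set {q..m})"
proof -
  have inj: "inj_on (word q m) {t. t permutes {q..m}}"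
  proof (rule inj_onI)
    fix s t assume "s \<in> {t. t permutes {q..m}}" "t \<in> {t. t permutes {q..m}}"
      and eq: "word q m s = word q m t"
    then have st: "s permutes {q..m}" "t permutes {q..m}" by auto
    show "s = t"
    proof
      fix i
      show "s i = t i"
      proof (cases "i \<in> {q..m}")
        case True
        then have "i \<in> set [q..<Suc m]"
          by (simp only: set_upt atLeastLessThanSuc_atLeastAtMost)
        with eq[unfolded map_eq_conv] show ?thesis by (rule bspec)
      next
        case False
        then show ?thesis using st by (simp add: permutes_not_in)
      qed
    qed
  qed
  moreover have "word q m ` {t. t permutes {q..m}} = permutations_of_set {q..m}"
  proof (rule card_subset_eq)
    show "finite (permutations_of_set {q..m})" by simp
    show "word q m ` {t. t permutes {q..m}} \<subseteq> permutations_of_set {q..m}"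
    proof (rule image_subsetI)
      fix t assume "t \<in> {t. t permutes {q..m}}"
      then have t: "t permutes {q..m}" by simp
      show "word q m t \<in> permutations_of_set {q..m}"
      proof (rule permutations_of_setI)
        show "set (word q m t) = {q..m}" unfolding set_word by (rule permutes_image[OF t])
        show "distinct (word q m t)"
          unfolding distinct_map using permutes_inj_on[OF t] by (simp del: upt_Suc)
      qed
    qed
    show "card (word q m ` {t. t permutes {q..m}}) = card (permutations_of_set {q..m})"
      unfolding card_image[OF inj] by (simp add: card_permutations)
  qed
  ultimately show ?thesis by (simp add: bij_betw_def)
qed

lemma bij_betw_foata:
  assumes "finite A"
  shows "bij_betw foata (permutations_of_set A) (permutations_of_set A)"
proof -
  have "foata ` permutations_of_set A \<subseteq> permutations_of_set A"
    by (auto simp: permutations_of_set_def set_foata distinct_foata)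
  moreover have "inj_on foata (permutations_of_set A)"
    by (rule inj_onI) (auto simp: permutations_of_set_def intro: foata_inject)
  ultimately show ?thesis
    using endo_inj_surj[of "permutations_of_set A" foata] by (simp add: bij_betw_def)
qed

lemma inv_q_word:
  assumes t: "t permutes {q..m}" and q: "1 \<le> q"
  shows "inv_q q m t = inversions (word q m t)"
  unfolding inv_q_cut_code inversions_word
  by (rule sum.cong) (use q in \<open>simp_all add: cut_code_upper[OF t q] larger_left_upper[OF t q]\<close>)

lemma Des_q_upper:
  assumes t: "t permutes {q..m}" and q: "1 \<le> q"
  shows "Des_q q m t = {i \<in> {q..<m}. t (i + 1) < t i}"
  unfolding Des_q_cut_code[OF permutes_inj[OF t] q]
proof (rule Collect_cong, rule conj_cong[OF refl])
  fix i assume "i \<in> {q..<m}"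
  then have i: "i \<in> {1..m}" "i + 1 \<in> {1..m}" "1 \<le> i" using q by auto
  show "cut_code q m t i < cut_code q m t (i + 1) \<longleftrightarrow> t (i + 1) < t i"
    unfolding cut_code_upper[OF t q i(1)] cut_code_upper[OF t q i(2)]
    by (rule larger_left_Suc[OF permutes_inj[OF t] i(3), symmetric])
qed

lemma rmaj_q_word:
  assumes t: "t permutes {q..m}" and q: "1 \<le> q"
  shows "rmaj_q q m t = rev_major (word q m t)"
  unfolding rmaj_q_def rev_major_word Des_q_upper[OF t q] ..

lemma Des_q_inv_word:
  assumes t: "t permutes {q..m}" and q: "1 \<le> q"
  shows "Des_q q m (inv t) = {k \<in> {q..<m}. precedes (word q m t) (k + 1) k}"
  unfolding Des_q_upper[OF permutes_inv[OF t] q]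
proof (rule Collect_cong, rule conj_cong[OF refl])
  fix k assume k: "k \<in> {q..<m}"
  have "inv t k \<in> {q..m}" "inv t (k + 1) \<in> {q..m}"
    using k permutes_in_image[OF permutes_inv[OF t]] by auto
  moreover have "i = inv t u \<longleftrightarrow> t i = u" for i u
    using permutes_inv_eq[OF t, of u i] by auto
  ultimately show "inv t (k + 1) < inv t k \<longleftrightarrow> precedes (word q m t) (k + 1) k"
    unfolding precedes_word by (auto simp flip: \<open>\<And>i u. i = inv t u \<longleftrightarrow> t i = u\<close>)
qed

text \<open>
  The summand one accounts for the first letter, which is always a left-to-right minimum but stands
  at position \<open>q\<close>, outside \<open>Del_q\<close>.
\<close>

lemma card_left_minima_word:
  assumes t: "t permutes {q..m}" and q: "1 \<le> q" "q \<le> m"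
  shows "card (left_minima (word q m t)) = Suc (card (Del_q q m t))"
proof -
  have Del: "i \<in> Del_q q m t \<longleftrightarrow> (\<forall>j\<in>{q..<i}. t i < t j)" if i: "i \<in> {q+1..m}" for i
  proof -
    have "i \<in> {1..m}" using i q by simp
    then have "cut_code q m t i = card {j \<in> {q..<i}. t i < t j}"
      by (simp only: cut_code_upper[OF t q(1)] larger_left_upper[OF t q(1)])
    then have "i \<in> Del_q q m t \<longleftrightarrow> card {j \<in> {q..<i}. t i < t j} = card {q..<i}"
      unfolding Del_q_cut_code[OF permutes_inj[OF t] q(1)] using i by simp
    also have "\<dots> \<longleftrightarrow> {j \<in> {q..<i}. t i < t j} = {q..<i}"
    proof
      assume "card {j \<in> {q..<i}. t i < t j} = card {q..<i}"
      then show "{j \<in> {q..<i}. t i < t j} = {q..<i}"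
        by (rule card_subset_eq[rotated 2]) (simp, blast)
    qed (simp only:)
    also have "\<dots> \<longleftrightarrow> (\<forall>j\<in>{q..<i}. t i < t j)" by blast
    finally show ?thesis .
  qed
  have "{i \<in> {q..m}. \<forall>j\<in>{q..<i}. t i < t j} = insert q (Del_q q m t)" (is "?L = ?R")
  proof (rule set_eqI)
    fix i
    consider "i = q" | "i \<in> {q+1..m}" | "i < q \<or> m < i" by fastforce
    then show "i \<in> ?L \<longleftrightarrow> i \<in> ?R"
    proof cases
      case 1
      then show ?thesis using q by simp
    next
      case 2
      then show ?thesis using Del[OF 2] by simp
    next
      case 3
      then show ?thesis using q by (auto simp: Del_q_def)
    qed
  qed
  moreover have "q \<notin> Del_q q m t" "finite (Del_q q m t)" by (simp_all add: Del_q_def)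
  ultimately show ?thesis
    by (simp only: left_minima_word card_image[OF permutes_inj_on[OF t]] card_insert_disjoint not_False_eq_True)
qed

text \<open>
  The common shape of both sides: a sum over words in which the fibre sizes appear as a weight that
  depends only on the number of left-to-right minima.
\<close>

lemma inverse_descent_sum_words:
  fixes f :: "(nat \<Rightarrow> nat) \<Rightarrow> nat" and g :: "nat list \<Rightarrow> nat"
  assumes q: "1 \<le> q" "q \<le> m"
    and f: "\<And>p p'. p permutes {1..m} \<Longrightarrow> p' permutes {1..m} \<Longrightarrow>
              cut_code q m p = cut_code q m p' \<Longrightarrow> f p = f p'"
    and g: "\<And>t. t permutes {q..m} \<Longrightarrow> f t = g (word q m t)"
  shows "(\<Sum>p \<in> {p. p permutes {1..m} \<and> Des_q q m (inv p) = B}. monom (1 :: int) (f p))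
    = (\<Sum>w \<in> permutations_of_set {q..m}.
        of_nat (fact q * q ^ (card (left_minima w) - 1)) *
        (if {k \<in> {q..<m}. precedes w (k + 1) k} = B then monom 1 (g w) else 0))"
proof -
  let ?G = "\<lambda>p. if Des_q q m (inv p) = B then monom (1 :: int) (f p) else 0"
  have "(\<Sum>p \<in> {p. p permutes {1..m} \<and> Des_q q m (inv p) = B}. monom (1 :: int) (f p))
      = (\<Sum>p | p permutes {1..m}. ?G p)"
    by (rule sum.mono_neutral_cong_left) (auto simp: finite_perms)
  also have "\<dots> = (\<Sum>t | t permutes {q..m}. of_nat (fact q * q ^ card (Del_q q m t)) * ?G t)"
  proof (rule sum_over_transversal[OF q])
    fix p p' assume p: "p permutes {1..m}" "p' permutes {1..m}"
      and eq: "cut_code q m p = cut_code q m p'"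
    have "Des_q q m (inv p) = Des_q q m (inv p')"
      using permutes_inj[OF permutes_inv[OF p(1)]] permutes_inj[OF permutes_inv[OF p(2)]] q(1)
      by (simp only: Des_q_cut_code cut_code_inv[OF p eq])
    then show "?G p = ?G p'" using f[OF p eq] by simp
  qed
  also have "\<dots> = (\<Sum>t | t permutes {q..m}.
      of_nat (fact q * q ^ (card (left_minima (word q m t)) - 1)) *
      (if {k \<in> {q..<m}. precedes (word q m t) (k + 1) k} = B
       then monom 1 (g (word q m t)) else 0))"
  proof (rule sum.cong[OF refl])
    fix t assume "t \<in> {t. t permutes {q..m}}"
    then have t: "t permutes {q..m}" by simp
    show "of_nat (fact q * q ^ card (Del_q q m t)) * ?G t
      = of_nat (fact q * q ^ (card (left_minima (word q m t)) - 1)) *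
      (if {k \<in> {q..<m}. precedes (word q m t) (k + 1) k} = B
       then monom 1 (g (word q m t)) else 0)"
      unfolding card_left_minima_word[OF t q] Des_q_inv_word[OF t q(1)] g[OF t] diff_Suc_1 ..
  qed
  also have "\<dots> = (\<Sum>w \<in> permutations_of_set {q..m}.
        of_nat (fact q * q ^ (card (left_minima w) - 1)) *
        (if {k \<in> {q..<m}. precedes w (k + 1) k} = B then monom 1 (g w) else 0))"
    by (rule sum.reindex_bij_betw[OF bij_betw_word[OF q]])
  finally show ?thesis .
qed

section \<open>Equidistribution\<close>

theorem theorem11p4:
  fixes n q :: nat and B :: "nat set"
  assumes "n \<ge> 1" and "q \<ge> 1" and "B \<subseteq> {q..n + q - 1}"
  shows "(\<Sum>p \<in> {p. p permutes {1..n + q - 1} \<and> Des_q q (n + q - 1) (inv p) = B}.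
            monom (1 :: int) (inv_q q (n + q - 1) p))
       = (\<Sum>p \<in> {p. p permutes {1..n + q - 1} \<and> Des_q q (n + q - 1) (inv p) = B}.
            monom (1 :: int) (rmaj_q q (n + q - 1) p))"
proof -
  define m where "m = n + q - 1"
  have q: "1 \<le> q" "q \<le> m" using assms by (auto simp: m_def)
  let ?W = "permutations_of_set {q..m}"
  let ?term = "\<lambda>g w. of_nat (fact q * q ^ (card (left_minima w) - 1)) *
    (if {k \<in> {q..<m}. precedes w (k + 1) k} = B then monom (1 :: int) (g w) else 0)"
  have "(\<Sum>p \<in> {p. p permutes {1..m} \<and> Des_q q m (inv p) = B}. monom (1 :: int) (inv_q q m p))
      = (\<Sum>w\<in>?W. ?term inversions w)"
  proof (rule inverse_descent_sum_words[OF q])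
    fix p p' assume "cut_code q m p = cut_code q m p'"
    then show "inv_q q m p = inv_q q m p'" by (simp only: inv_q_cut_code)
  qed (rule inv_q_word[OF _ q(1)])
  also have "\<dots> = (\<Sum>w\<in>?W. ?term inversions (foata w))"
    by (rule sum.reindex_bij_betw[OF bij_betw_foata, symmetric]) simp
  also have "\<dots> = (\<Sum>w\<in>?W. ?term rev_major w)"
  proof (rule sum.cong[OF refl])
    fix w assume "w \<in> ?W"
    then have w: "distinct w" by (simp add: permutations_of_set_def)
    have "precedes (foata w) (k + 1) k = precedes w (k + 1) k" for k
      \<comment> \<open>no integer lies strictly between \<open>k\<close> and \<open>k + 1\<close>\<close>
      by (rule precedes_foata[OF w]) linarith
    then show "?term inversions (foata w) = ?term rev_major w"
      by (simp only: left_minima_foata[OF w] inversions_foata[OF w])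
  qed
  also have "\<dots> = (\<Sum>p \<in> {p. p permutes {1..m} \<and> Des_q q m (inv p) = B}.
      monom (1 :: int) (rmaj_q q m p))"
  proof (rule inverse_descent_sum_words[OF q, symmetric])
    fix p p' assume p: "p permutes {1..m}" "p' permutes {1..m}"
      and eq: "cut_code q m p = cut_code q m p'"
    show "rmaj_q q m p = rmaj_q q m p'"
      unfolding rmaj_q_def Des_q_cut_code[OF permutes_inj[OF p(1)] q(1)]
        Des_q_cut_code[OF permutes_inj[OF p(2)] q(1)] eq ..
  qed (rule rmaj_q_word[OF _ q(1)])
  finally show ?thesis unfolding m_def .
qed

end
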